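(* Fix an orthant index $r$ (i.e. a sign matrix $J^{(r)}=\mathrm{diag}(j^{(r)}_{11},\dots,j^{(r)}_{nn})$, $j^{(r)}_{ii}\in\{-1,1\}$). Let $X\in\mathbb R^n$ be the state and let $\xi\in\mathbb R^n$ with $\xi>0$ (componentwise). If the feedforward control is designed as $$\underline u^{(r)}=(\hat C^{-1}-C\hat C^{-1})\underline v+U(J^{(r)}X)+\mathbf 1\tfrac{\beta}{2}+J^{(r)}\xi,$$ then the vector $$\tilde b^{(r)}:=J^{(r)}\Big((\hat C C\hat C^{-1}-I)\underline v+\hat C\big(\underline u^{(r)}-U(J^{(r)}X)-\mathbf 1\tfrac{\beta}{2}\big)\Big)$$ is nonnegative, i.e. all its components are $\ge 0$.
   Context: Setting: $N=\{1,\dots,n\}$; $C=[c_{il}]\in\mathbb R^{n\times n}$ with $c_{il}\in[0,1]$, $c_{ii}=0$; $\hat c_{ii}:=1-\sum_{j\ne i}c_{ji}$, assumed $>0$ for every $i$; $\hat C:=\mathrm{diag}(\hat c_{11},\dots,\hat c_{nn})$; $\underline v\in\mathbb R^n$ is given; $\beta\ge 0$ is a real number; $\mathbf 1$ is the all-ones vector; $I$ is the identity matrix. Failure term: $U(x)=[U_i(x)]_i$ with $U_i(x)=\beta/2$ if $x_i<0$ and $U_i(x)=-\beta/2$ if $x_i\ge 0$. The vector $\tilde b^{(r)}$ is the input term of the closed-loop system $X(t+1)=\tilde A^{(r)}X(t)+\tilde b^{(r)}$, where $\tilde A^{(r)}=J^{(r)}\hat C C\hat C^{-1}J^{(r)}+\hat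 C\tilde K^{(r)}$ for a feedback matrix $\tilde K^{(r)}\in\mathbb R^{n\times n}$ (which plays no role in the claim). *)

theory Defs
  imports "HOL-Analysis.Analysis"
begin

definition diag_mat :: "real ^ 'n \<Rightarrow> real ^ 'n ^ 'n" where
  "diag_mat d = (\<chi> i j. if i = j then d $ i else 0)"

definition sign_matrix :: "real ^ 'n ^ 'n \<Rightarrow> bool" where
  "sign_matrix J \<longleftrightarrow> (\<exists>d. (\<forall>i. d $ i \<in> {-1, 1}) \<and> J = diag_mat d)"

text \<open>The sum runs over column \<open>i\<close> of \<open>C\<close>; entry \<open>c\<^sub>i\<^sub>l\<close> is \<open>C $ i $ l\<close>.\<close>

definition chat :: "real ^ 'n ^ 'n \<Rightarrow> 'n::finite \<Rightarrow> real" where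
  "chat C i = 1 - (\<Sum>j \<in> UNIV - {i}. C $ j $ i)"

definition Chat :: "real ^ 'n ^ 'n \<Rightarrow> real ^ 'n ^ ('n::finite)" where
  "Chat C = diag_mat (\<chi> i. chat C i)"

definition failure_term :: "real \<Rightarrow> real ^ 'n \<Rightarrow> real ^ 'n" where
  "failure_term \<beta> x = (\<chi> i. if x $ i < 0 then \<beta> / 2 else - (\<beta> / 2))"

definition feedforward ::
  "real ^ 'n ^ 'n \<Rightarrow> real ^ 'n \<Rightarrow> real \<Rightarrow> real ^ 'n ^ 'n \<Rightarrow> real ^ 'n \<Rightarrow> real ^ 'n \<Rightarrow> real ^ ('n::finite)" where
  "feedforward C v \<beta> J X \<xi> =
     (matrix_inv (Chat C) - C ** matrix_inv (Chat C)) *v v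
     + failure_term \<beta> (J *v X) + (\<beta> / 2) *\<^sub>R vec 1 + J *v \<xi>"

definition btilde ::
  "real ^ 'n ^ 'n \<Rightarrow> real ^ 'n \<Rightarrow> real \<Rightarrow> real ^ 'n ^ 'n \<Rightarrow> real ^ 'n \<Rightarrow> real ^ 'n \<Rightarrow> real ^ ('n::finite)" where
  "btilde C v \<beta> J X u =
     J *v ((Chat C ** C ** matrix_inv (Chat C) - mat 1) *v v
           + Chat C *v (u - failure_term \<beta> (J *v X) - (\<beta> / 2) *\<^sub>R vec 1))"

end

theory Submission
  imports Defs
begin

text \<open>
  The feedforward term cancels the drift, since
  \<open>Chat (Chat\<^sup>-\<^sup>1 - C Chat\<^sup>-\<^sup>1) = 1 - Chat C Chat\<^sup>-\<^sup>1\<close>; what remains of \<open>btilde\<close> is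
  \<open>J Chat J \<xi>\<close>, which equals \<open>Chat \<xi>\<close> because diagonal matrices commute and \<open>J\<^sup>2 = 1\<close>.
\<close>

lemma diag_mat_mult_vec_nth: "(diag_mat d *v x) $ i = d $ i * x $ i"
  by (simp add: diag_mat_def matrix_vector_mult_def if_distrib [of "\<lambda>a. a * _"] cong: if_cong)

lemma diag_mat_mult_inv:
  fixes d :: "real ^ 'n::finite"
  assumes "\<And>i. d $ i \<noteq> 0"
  shows "diag_mat d ** matrix_inv (diag_mat d) = mat 1"
proof -
  \<comment> \<open>The witness is the entrywise reciprocal.\<close>
  have "diag_mat d ** diag_mat (\<chi> i. inverse (d $ i)) = mat 1"
    by (simp add: matrix_eq vec_eq_iff diag_mat_mult_vec_nth assms flip: matrix_vector_mul_assoc)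
  \<comment> \<open>\<open>matrix_inv\<close> chooses some two-sided inverse; for a square matrix
    the right inverse just built guarantees that one exists.\<close>
  then show ?thesis
    unfolding matrix_inv_def
    using someI_ex [OF invertible_def [THEN iffD1]] invertible_right_inverse by blast
qed

lemma btilde_feedforward:
  assumes "\<And>i. chat C i \<noteq> 0"
  shows "btilde C v \<beta> J X (feedforward C v \<beta> J X \<xi>) = J *v (Chat C *v (J *v \<xi>))"
proof -
  have inv: "Chat C ** matrix_inv (Chat C) = mat 1"
    unfolding Chat_def by (rule diag_mat_mult_inv) (simp add: assms)
  \<comment> \<open>The subtracted terms are exactly those built into \<open>feedforward\<close>, so
    only the parts in \<open>v\<close> and \<open>\<xi>\<close> survive.\<close>
  have "Chat C *v (feedforward C v \<beta> J X \<xi> - failure_term \<beta> (J *v X) - (\<beta> / 2) *\<^sub>R vec 1)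
      = v - (Chat C ** C ** matrix_inv (Chat C)) *v v + Chat C *v (J *v \<xi>)"
    by (simp add: feedforward_def matrix_vector_right_distrib matrix_vector_mult_diff_rdistrib
        matrix_vector_mult_diff_distrib matrix_vector_mul_assoc matrix_mul_assoc inv)
  then show ?thesis
    by (simp add: btilde_def matrix_vector_mult_diff_rdistrib)
qed

theorem theorem4:
  fixes C J :: "real ^ 'n::finite ^ 'n"
    and v X \<xi> u :: "real ^ 'n"
    and \<beta> :: real
  assumes C_range: "\<And>i l. C $ i $ l \<in> {0..1}"
    and C_diag: "\<And>i. C $ i $ i = 0"
    and chat_pos: "\<And>i. chat C i > 0"
    and beta: "\<beta> \<ge> 0"
    and J: "sign_matrix J"
    and xi: "\<And>i. \<xi> $ i > 0"
    and u: "u = feedforward C v \<beta> J X \<xi>"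
  shows "\<forall>i. btilde C v \<beta> J X u $ i \<ge> 0"
proof
  fix i
  obtain d where d: "d $ i \<in> {-1, 1}" and J_eq: "J = diag_mat d"
    using J by (auto simp: sign_matrix_def)
  have "btilde C v \<beta> J X u = J *v (Chat C *v (J *v \<xi>))"
    unfolding u by (rule btilde_feedforward) (metis chat_pos less_irrefl)
  \<comment> \<open>Both copies of \<open>J\<close> act on component \<open>i\<close> by the factor
    \<open>d $ i\<close>, and its square is 1 for either sign.\<close>
  then have "btilde C v \<beta> J X u $ i = chat C i * \<xi> $ i"
    using d by (auto simp: J_eq Chat_def diag_mat_mult_vec_nth)
  then show "btilde C v \<beta> J X u $ i \<ge> 0"
    by (simp add: chat_pos xi less_imp_le)
qed

end
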